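(* Let $\Lambda \ge 1$ and $\lambda \in \{1,\dots,\Lambda\}$ be integers, let $K = \binom{\Lambda}{\lambda}$, and let $N \ge K$ be an integer. Consider the multi-access coded caching problem with combinatorial topology with parameters $(\Lambda,\lambda,N,M)$, and let $R^\star_{\mathrm{u}}(M)$ denote its optimal worst-case communication load under uncoded cache placement. Then, as a function of $M \in [0,N]$, $R^\star_{\mathrm{u}}$ is the piecewise linear curve with corner points $$ (M, R^\star_{\mathrm{u}}) = \left( t\,\frac{N}{\Lambda},\ \frac{\binom{\Lambda}{t+\lambda}}{\binom{\Lambda}{t}} \right), \qquad t \in \{0,1,\dots,\Lambda\}. $$ That is, $R^\star_{\mathrm{u}}(tN/\Lambda) = \binom{\Lambda}{t+\lambda}/\binom{\Lambda}{t}$ for every $t \in \{0,1,\dots,\Lambda\}$, and $R^\star_{\mathrm{u}}$ is affine on each interval $[tN/\Lambda,(t+1)N/\Lambda]$ with $t\in\{0,\dots,\Lambda-1\}$.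
   Context: Convention: $\binom{n}{k} = 0$ whenever $n<0$, $k<0$ or $n<k$. Write $[n]=\{1,\dots,n\}$. Multi-access coded caching (MACC) problem with combinatorial topology, parameters $(\Lambda,\lambda,N,M)$. A server has access to a library of $N$ files $W_1,\dots,W_N$, each consisting of $B$ arbitrary bits (equivalently, for information-theoretic purposes, independent uniformly random bits). There are $\Lambda$ caches, indexed by $[\Lambda]$, each able to store at most $MB$ bits. There are $K=\binom{\Lambda}{\lambda}$ users, exactly one for each subset $\mathcal{U}\subseteq[\Lambda]$ with $|\mathcal{U}|=\lambda$; the user identified by $\mathcal{U}$ can read, at no cost, the entire contents of all caches in $\mathcal{U}$ and of no other caches. The server is connected to all users through an error-free broadcast link. Placement phase: the caches are filled without knowledge of the users' later requests. The placement is uncoded if bits of the files are simply copied into the caches; that is, each cache stores the values of the file bits at a chosen set of (file, bit position) pairs, of cardinality at most $MB$. Equivalently, each file $W_n$ is partitioned into disjoint subfiles $W_{n,\mathcal{T}}$, $\mathcal{T}\subseteq[\Lambda]$, where $W_{n,\mathcal{T}}$ consists of the bits of $W_n$ stored by exactly the caches in $\mathcal{T}$. Delivery phase: a demand vector $\bm{d}=(d_{\mathcal{U}} : \mathcal{U}\subseteq[\Lambda], |\mathcal{U}|=\lambda)$ with $d_{\mathcal{U}}\in[N]$ is revealed to the server and all users. The server broadcasts a message that is a function of the library, the placement and $\bm{d}$. Each user $\mathcal{U}$ must recover the file $W_{d_{\mathcal{U}}}$ without error from the broadcast message and the contents of the caches in $\mathcal{U}$ (the placement rule and $\bm{d}$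 being known to everyone). Load: a pair $(M,R)$ is achievable under uncoded placement if there exists a caching-and-delivery procedure with uncoded placement (for some file size $B$, which is a free design parameter) using caches of at most $MB$ bits, such that for every possible demand vector $\bm{d}\in[N]^K$ every user recovers its requested file and the number of broadcast bits is at most $RB$. Define $$R^\star_{\mathrm{u}}(M) = \inf\{R : (M,R) \text{ is achievable under uncoded placement}\}.$$ *)

theory Defs
  imports Complex_Main "HOL-Library.FuncSet"
begin

text \<open>
  Multi-access coded caching with combinatorial topology: \<open>\<Lambda>\<close> caches, files of \<open>B\<close> bits, and one
  user for every set of \<open>l\<close> caches. Files are numbered \<open>1, \<dots>, N\<close> and caches \<open>1, \<dots>, \<Lambda>\<close>; a bit of
  the library is addressed by a pair \<open>(n, i)\<close> of a file and a position \<open>i < B\<close>.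
\<close>

definition libraries :: "nat \<Rightarrow> nat \<Rightarrow> (nat \<Rightarrow> bool list) set" where
  "libraries N B = {1..N} \<rightarrow>\<^sub>E {w. length w = B}"

definition users :: "nat \<Rightarrow> nat \<Rightarrow> nat set set" where
  "users \<Lambda> l = {U. U \<subseteq> {1..\<Lambda>} \<and> card U = l}"

definition demands :: "nat \<Rightarrow> nat \<Rightarrow> nat \<Rightarrow> (nat set \<Rightarrow> nat) set" where
  "demands \<Lambda> l N = users \<Lambda> l \<rightarrow>\<^sub>E {1..N}"

definition uncoded_placement ::
    "nat \<Rightarrow> nat \<Rightarrow> nat \<Rightarrow> real \<Rightarrow> (nat \<Rightarrow> (nat \<times> nat) set) \<Rightarrow> bool" where
  "uncoded_placement \<Lambda> N B M Z \<longleftrightarrow>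
     (\<forall>c\<in>{1..\<Lambda>}. Z c \<subseteq> {1..N} \<times> {..<B} \<and> real (card (Z c)) \<le> M * real B)"

definition cache_content ::
    "(nat \<Rightarrow> (nat \<times> nat) set) \<Rightarrow> (nat \<Rightarrow> bool list) \<Rightarrow> nat \<Rightarrow> nat \<times> nat \<Rightarrow> bool" where
  "cache_content Z W c = restrict (\<lambda>(n, i). W n ! i) (Z c)"

text \<open>
  The demand \<open>d\<close> and the placement \<open>Z\<close> are known to everyone, so the encoder \<open>X\<close> and the
  decoders may depend on them. The message has the same length \<open>L\<close> for all libraries, so its
  length carries no information about the files.
\<close>

definition delivers ::
    "nat \<Rightarrow> nat \<Rightarrow> nat \<Rightarrow> nat \<Rightarrow> (nat \<Rightarrow> (nat \<times> nat) set) \<Rightarrow> (nat set \<Rightarrow> nat) \<Rightarrow>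
     nat \<Rightarrow> ((nat \<Rightarrow> bool list) \<Rightarrow> bool list) \<Rightarrow> bool" where
  "delivers \<Lambda> l N B Z d L X \<longleftrightarrow>
     (\<forall>W\<in>libraries N B. length (X W) = L) \<and>
     (\<forall>U\<in>users \<Lambda> l. \<exists>dec :: bool list \<Rightarrow> (nat \<Rightarrow> nat \<times> nat \<Rightarrow> bool) \<Rightarrow> bool list.
        \<forall>W\<in>libraries N B. dec (X W) (restrict (cache_content Z W) U) = W (d U))"

definition achievable_uncoded :: "nat \<Rightarrow> nat \<Rightarrow> nat \<Rightarrow> real \<Rightarrow> real \<Rightarrow> bool" where
  "achievable_uncoded \<Lambda> l N M R \<longleftrightarrow>
     (\<exists>B>0. \<exists>Z. uncoded_placement \<Lambda> N B M Z \<and>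
        (\<forall>d\<in>demands \<Lambda> l N. \<exists>L X. delivers \<Lambda> l N B Z d L X \<and> real L \<le> R * real B))"

text \<open>
  For \<open>M \<ge> 0\<close>, the range of interest, the infimum is taken over a nonempty set (sending the whole
  library achieves \<open>R = N\<close>) that is bounded below by \<open>0\<close> when \<open>N \<ge> 1\<close>.
\<close>

definition optimal_load_uncoded :: "nat \<Rightarrow> nat \<Rightarrow> nat \<Rightarrow> real \<Rightarrow> real" where
  "optimal_load_uncoded \<Lambda> l N M = Inf {R. achievable_uncoded \<Lambda> l N M R}"

definition affine_fun_on :: "real set \<Rightarrow> (real \<Rightarrow> real) \<Rightarrow> bool" where
  "affine_fun_on S f \<longleftrightarrow> (\<exists>a b. \<forall>x\<in>S. f x = a * x + b)"

end

theory Submission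
  imports Defs "HOL-Combinatorics.Permutations"
begin

text \<open>
  Converse: for a permutation \<open>q\<close> of the caches and a demand of distinct files, the bits requested by
  a user all of whose caches come before all caches storing the bit are determined by the message
  and the remaining bits. In a random order the users preceding a bit stored in \<open>t\<close> caches number
  \<open>(\<Lambda> - t choose l) / (t + l choose l) = (\<Lambda> choose t + l) / (\<Lambda> choose t)\<close> on average. This is convex and
  decreasing in \<open>t\<close>, so the memory constraint on the average of \<open>t\<close> puts the load above the lines
  through consecutive corner points. Achievability: XOR multicasting to \<open>(t + l)\<close>-sets of caches at
  the corner points, and memory sharing in between. Only rational proportions can be shared with
  finite files, which is enough because the load is an infimum.
\<close>

section \<open>The corner loads\<close>

definition load :: "nat \<Rightarrow> nat \<Rightarrow> nat \<Rightarrow> real" where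
  "load \<Lambda> l t = real (\<Lambda> choose (t + l)) / real (\<Lambda> choose t)"

text \<open>Disjoint pairs of a \<open>t\<close>-set and an \<open>l\<close>-set can be counted by
  choosing the union first or the \<open>t\<close>-set first. The product form prepares a discrete
  product rule and is also what the count over random orders yields.\<close>

lemma load_alt:
  assumes "t \<le> \<Lambda>"
  shows "load \<Lambda> l t = real ((\<Lambda> - t) choose l) * (1 / real ((t + l) choose l))"
proof (cases "t + l \<le> \<Lambda>")
  case True
  have "(\<Lambda> choose (t + l)) * ((t + l) choose l) = (\<Lambda> choose t) * ((\<Lambda> - t) choose l)"
    using choose_mult[of t "t + l" \<Lambda>] True binomial_symmetric[of l "t + l"] by simp
  then have "real (\<Lambda> choose (t + l)) * real ((t + l) choose l)
      = real (\<Lambda> choose t) * real ((\<Lambda> - t) choose l)"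
    by (metis of_nat_mult)
  moreover have "(\<Lambda> choose t) > 0" "((t + l) choose l) > 0" using assms by auto
  ultimately show ?thesis by (simp add: load_def field_simps)
next
  case False
  then show ?thesis using assms by (simp add: load_def binomial_eq_0)
qed

lemma choose_succ_diff:
  assumes "t < \<Lambda>" "1 \<le> l"
  shows "real ((\<Lambda> - t) choose l) - real ((\<Lambda> - Suc t) choose l) = real ((\<Lambda> - Suc t) choose (l - 1))"
proof -
  obtain m where m: "\<Lambda> - t = Suc m" "\<Lambda> - Suc t = m"
    using assms(1) by (metis Suc_diff_Suc)
  obtain k where k: "l = Suc k" using assms(2) by (cases l) auto
  show ?thesis unfolding m k by simp
qed

text \<open>The absorption identity, rewritten with complementary binomials.\<close>

lemma inverse_choose_step:
  "1 / real ((Suc t + l) choose l) = 1 / real ((t + l) choose l) * (real t + 1) / (real t + 1 + real l)"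
proof -
  have "(t + 1) * ((Suc t + l) choose l) = (Suc t + l) * ((t + l) choose l)"
    using Suc_times_binomial[of t "t + l"]
      binomial_symmetric[of l "Suc t + l"] binomial_symmetric[of l "t + l"] by (simp add: algebra_simps)
  then have "real (t + 1) * real ((Suc t + l) choose l) = real (Suc t + l) * real ((t + l) choose l)"
    by (metis of_nat_mult)
  then have "(real t + 1) * real ((Suc t + l) choose l) = (real t + 1 + real l) * real ((t + l) choose l)"
    by (simp only: of_nat_add of_nat_Suc of_nat_1 add.commute add.left_commute)
  moreover have "1 / a = 1 / b * x / y" if "x * a = y * b" "a > 0" "b > 0" "y > 0" for a b x y :: real
    using that by (simp add: divide_simps)
  ultimately show ?thesis by simp
qed

text \<open>By \<open>load_alt\<close> the load is a product of two nonnegative, decreasing, convex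
  sequences, hence itself decreasing and convex. Convexity is phrased as shrinking successive
  drops.\<close>

lemma load_step:
  assumes "t < \<Lambda>" "1 \<le> l"
  shows "load \<Lambda> l (Suc t) \<le> load \<Lambda> l t"
    and "Suc t < \<Lambda> \<Longrightarrow> load \<Lambda> l (Suc t) - load \<Lambda> l (Suc (Suc t)) \<le> load \<Lambda> l t - load \<Lambda> l (Suc t)"
proof -
  define f where "f t = real ((\<Lambda> - t) choose l)" for t
  define g where "g t = 1 / real ((t + l) choose l)" for t
  have g_step: "g (Suc t) = g t * (real t + 1) / (real t + 1 + real l)" for t
    unfolding g_def by (rule inverse_choose_step)
  have g_pos: "g t > 0" for t by (simp add: g_def)
  have g_diff: "g t - g (Suc t) = g t * real l / (real t + 1 + real l)" for t
    unfolding g_step by (simp add: field_simps)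
  have g_dec: "g (Suc t) \<le> g t" for t
    using g_diff[of t] g_pos[of t] by (smt (verit) divide_nonneg_nonneg mult_nonneg_nonneg of_nat_0_le_iff)
  \<comment> \<open>In \<open>g_diff\<close> the numerator decreases with \<open>t\<close> while the
    denominator grows.\<close>
  have g_conv: "g (Suc t) - g (Suc (Suc t)) \<le> g t - g (Suc t)" for t
    unfolding g_diff
  proof (rule frac_le)
    show "g (Suc t) * real l \<le> g t * real l" using g_dec by (simp add: mult_right_mono)
  qed (use g_pos[of t] in auto)
  have f_diff: "f t - f (Suc t) = real ((\<Lambda> - Suc t) choose (l - 1))" if "t < \<Lambda>" for t
    unfolding f_def using choose_succ_diff[OF that assms(2)] .
  have f0: "f t \<ge> 0" for t by (simp add: f_def)
  have f_dec: "f (Suc t) \<le> f t" using f_diff[OF assms(1)] by (smt (verit) of_nat_0_le_iff)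
  have fg: "load \<Lambda> l t = f t * g t" if "t \<le> \<Lambda>" for t
    using load_alt[OF that] by (simp add: f_def g_def)
  have fg0: "load \<Lambda> l t = f t * g t" "load \<Lambda> l (Suc t) = f (Suc t) * g (Suc t)"
    using fg assms by auto
  show "load \<Lambda> l (Suc t) \<le> load \<Lambda> l t"
    unfolding fg0 using f_dec g_dec f0 g_pos by (intro mult_mono) (auto intro: less_imp_le)
  assume lt: "Suc t < \<Lambda>"
  \<comment> \<open>By Pascal's rule the drops of \<open>f\<close> are binomials with lower index
    \<open>l - 1\<close>, which shrink with their upper index.\<close>
  have f_conv: "f (Suc t) - f (Suc (Suc t)) \<le> f t - f (Suc t)"
    unfolding f_diff[OF assms(1)] f_diff[OF lt] by (simp add: binomial_right_mono)
  have f_dec2: "f (Suc (Suc t)) \<le> f (Suc t)" using f_diff[OF lt] by (smt (verit) of_nat_0_le_iff)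
  have fg2: "load \<Lambda> l (Suc (Suc t)) = f (Suc (Suc t)) * g (Suc (Suc t))" using fg lt by auto
  \<comment> \<open>Discrete product rule. Each of the four factors is nonnegative and is bounded by
    its counterpart one index earlier.\<close>
  have "load \<Lambda> l (Suc t) - load \<Lambda> l (Suc (Suc t))
      = (f (Suc t) - f (Suc (Suc t))) * g (Suc t) + f (Suc (Suc t)) * (g (Suc t) - g (Suc (Suc t)))"
    unfolding fg0 fg2 by (simp add: algebra_simps)
  also have "\<dots> \<le> (f t - f (Suc t)) * g t + f (Suc t) * (g t - g (Suc t))"
    using f_conv g_conv f_dec f_dec2 g_dec f0 g_pos
    by (intro add_mono mult_mono) (auto intro: less_imp_le)
  also have "\<dots> = load \<Lambda> l t - load \<Lambda> l (Suc t)"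
    unfolding fg0 by (simp add: algebra_simps)
  finally show "load \<Lambda> l (Suc t) - load \<Lambda> l (Suc (Suc t)) \<le> load \<Lambda> l t - load \<Lambda> l (Suc t)" .
qed

text \<open>Convexity makes the slopes \<open>D\<close> increase, so the line through two
  consecutive points stays below the sequence: induct forwards to the right of \<open>t\<close> and
  backwards to the left.\<close>

lemma load_ge_line:
  assumes "t < \<Lambda>" "1 \<le> l" "s \<le> \<Lambda>"
  shows "load \<Lambda> l t + (real s - real t) * (load \<Lambda> l (Suc t) - load \<Lambda> l t) \<le> load \<Lambda> l s"
proof -
  define D where "D t = load \<Lambda> l (Suc t) - load \<Lambda> l t" for t
  have D_step: "D i \<le> D (Suc i)" if "Suc i < \<Lambda>" for i
    using load_step(2)[OF Suc_lessD[OF that] assms(2) that] unfolding D_def by linarith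
  have D_mono: "i \<le> j \<Longrightarrow> j < \<Lambda> \<Longrightarrow> D i \<le> D j" for i j
  proof (induction rule: dec_induct)
    case (step n)
    then show ?case using D_step[of n] by linarith
  qed simp
  show ?thesis
  proof (cases "t \<le> s")
    case True
    then show ?thesis using assms(3)
    proof (induction s rule: dec_induct)
      case (step n)
      have "D t \<le> D n" using D_mono step by auto
      then show ?case using step by (simp add: D_def algebra_simps)
    qed simp
  next
    case False
    then have "s \<le> t" by simp
    then show ?thesis
    proof (induction s rule: inc_induct)
      case (step n)
      have "D n \<le> D t" using D_mono step assms by auto
      then show ?case using step by (simp add: D_def algebra_simps)
    qed simp
  qed
qed

section \<open>Random orders of the caches\<close>

text \<open>Collect the elements with the \<open>l\<close> smallest values of \<open>q\<close>,
  adding the minimum of the rest each time. Together with uniqueness this classifies orders by which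
  elements come first.\<close>

lemma initial_segment_exists:
  fixes q :: "'a \<Rightarrow> nat"
  assumes "finite S" "inj_on q S" "l \<le> card S"
  shows "\<exists>U. U \<subseteq> S \<and> card U = l \<and> (\<forall>u\<in>U. \<forall>v\<in>S - U. q u < q v)"
  using assms(3)
proof (induction l)
  case 0
  show ?case by (rule exI[of _ "{}"]) simp
next
  case (Suc l)
  then obtain U where U: "U \<subseteq> S" "card U = l" "\<forall>u\<in>U. \<forall>v\<in>S - U. q u < q v" by auto
  have "S - U \<noteq> {}" using U Suc.prems by auto
  moreover have fin: "finite (S - U)" using assms(1) by auto
  ultimately have "Min (q ` (S - U)) \<in> q ` (S - U)" by (intro Min_in) auto
  then obtain x where x: "x \<in> S - U" "q x = Min (q ` (S - U))" by auto
  have min: "q x < q v" if "v \<in> S - insert x U" for v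
  proof -
    have "q x \<le> q v" unfolding x(2) using that fin by (intro Min_le) auto
    moreover have "q x \<noteq> q v" using that x assms(2) by (auto dest: inj_onD)
    ultimately show ?thesis by simp
  qed
  have "finite U" using U(1) assms(1) finite_subset by blast
  then have "card (insert x U) = Suc l" using U x by simp
  then show ?case using U x min by (intro exI[of _ "insert x U"]) auto
qed

text \<open>Distinct sets of equal size each have an element outside the other, and those two
  elements would have to precede each other.\<close>

lemma initial_segment_unique:
  fixes q :: "'a \<Rightarrow> nat"
  assumes "finite S" "U \<subseteq> S" "V \<subseteq> S" "card U = card V"
    and "\<forall>u\<in>U. \<forall>v\<in>S - U. q u < q v" "\<forall>u\<in>V. \<forall>v\<in>S - V. q u < q v"
  shows "U = V"
proof (rule ccontr)
  assume "U \<noteq> V"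
  moreover have fin: "finite U" "finite V" using assms finite_subset by blast+
  ultimately have "\<not> U \<subseteq> V" "\<not> V \<subseteq> U"
    using card_subset_eq[of V U] card_subset_eq[of U V] assms(4) by auto
  then obtain u v where "u \<in> U - V" "v \<in> V - U" by auto
  then have "q u < q v" "q v < q u" using assms by auto
  then show False by simp
qed

text \<open>The value \<open>q x\<close> is the position of \<open>x\<close> in the order. For empty
  \<open>T\<close> the condition is vacuous, so a bit stored in no cache counts for every user
  requesting it.\<close>

definition precedes :: "('a \<Rightarrow> nat) \<Rightarrow> 'a set \<Rightarrow> 'a set \<Rightarrow> bool" where
  "precedes q U T \<longleftrightarrow> (\<forall>u\<in>U. \<forall>v\<in>T. q u < q v)"

text \<open>Symmetry of a random order: since the unions agree, bijections from \<open>U\<close> to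
  \<open>U'\<close> and from \<open>T\<close> to \<open>T'\<close> combine to a permutation
  \<open>h\<close>, and composing with \<open>h\<close> matches the two families.\<close>

lemma card_precedes_cong:
  assumes "U \<union> T = U' \<union> T'" "U \<inter> T = {}" "U' \<inter> T' = {}" "card U = card U'" "card T = card T'"
    and "U \<union> T \<subseteq> A" "finite A"
  shows "card {q. q permutes A \<and> precedes q U T} = card {q. q permutes A \<and> precedes q U' T'}"
proof -
  have fin: "finite U" "finite T" "finite U'" "finite T'"
  proof -
    have "finite (U \<union> T)" using assms(6,7) finite_subset by blast
    moreover from this have "finite (U' \<union> T')" using assms(1) by simp
    ultimately show "finite U" "finite T" "finite U'" "finite T'" by auto
  qed
  obtain f where f: "bij_betw f U U'" using finite_same_card_bij[OF fin(1,3) assms(4)] by blast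
  obtain g where g: "bij_betw g T T'" using finite_same_card_bij[OF fin(2,4) assms(5)] by blast
  define h where "h x = (if x \<in> U then f x else if x \<in> T then g x else x)" for x
  have hU: "bij_betw h U U'" using f bij_betw_cong[of U h f U'] by (simp add: h_def)
  have hT: "bij_betw h T T'"
  proof -
    have "h x = g x" if "x \<in> T" for x using that assms(2) by (auto simp: h_def)
    then show ?thesis using g bij_betw_cong[of T h g T'] by simp
  qed
  have "bij_betw h (U \<union> T) (U' \<union> T')"
    using bij_betw_combine[OF hU hT assms(3)] .
  then have "h permutes (U \<union> T)" using assms(1)
    by (intro bij_imp_permutes) (auto simp: h_def)
  then have h: "h permutes A" using assms(6) permutes_subset by blast
  have im: "h ` U = U'" "h ` T = T'" using hU hT by (auto simp: bij_betw_def)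
  have "bij_betw (\<lambda>q. q \<circ> h) {q. q permutes A \<and> precedes q U' T'} {q. q permutes A \<and> precedes q U T}"
  proof (rule bij_betwI[where g = "\<lambda>q. q \<circ> inv h"])
    show "(\<lambda>q. q \<circ> h) \<in> {q. q permutes A \<and> precedes q U' T'} \<rightarrow> {q. q permutes A \<and> precedes q U T}"
      using h im by (auto simp: precedes_def intro: permutes_compose)
    have "inv h u \<in> U" if "u \<in> U'" for u using that im permutes_inverses(2)[OF h] by auto
    moreover have "inv h u \<in> T" if "u \<in> T'" for u using that im permutes_inverses(2)[OF h] by auto
    ultimately show "(\<lambda>q. q \<circ> inv h) \<in> {q. q permutes A \<and> precedes q U T} \<rightarrow> {q. q permutes A \<and> precedes q U' T'}"
      using permutes_inv[OF h] by (auto simp: precedes_def intro: permutes_compose)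
  qed (auto simp: fun_eq_iff permutes_inverses[OF h])
  then show ?thesis by (simp add: bij_betw_same_card)
qed

text \<open>Each order of \<open>A\<close> has exactly one initial segment of size
  \<open>card U\<close> within the union of \<open>U\<close> and \<open>T\<close>, and by symmetry
  all candidate segments occur equally often.\<close>

lemma card_precedes:
  assumes "finite A" "U \<subseteq> A" "T \<subseteq> A" "U \<inter> T = {}"
  shows "card {q. q permutes A \<and> precedes q U T} * ((card T + card U) choose card U) = fact (card A)"
proof -
  define S where "S = U \<union> T"
  define \<V> where "\<V> = {V. V \<subseteq> S \<and> card V = card U}"
  have fin: "finite U" "finite T" "finite S" using assms finite_subset unfolding S_def by auto
  have cS: "card S = card T + card U" unfolding S_def using fin assms by (simp add: card_Un_disjoint)
  have finV: "finite \<V>" unfolding \<V>_def using fin by simp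
  have eq: "card {q. q permutes A \<and> precedes q V (S - V)} = card {q. q permutes A \<and> precedes q U T}"
    if "V \<in> \<V>" for V
  proof (rule card_precedes_cong)
    show "card (S - V) = card T"
      using that cS fin by (auto simp: \<V>_def card_Diff_subset finite_subset)
  qed (use that assms in \<open>auto simp: \<V>_def S_def\<close>)
  have finP: "finite {q. q permutes A}" using assms finite_permutations by blast
  have "card {q. q permutes A} = card (\<Union>V\<in>\<V>. {q. q permutes A \<and> precedes q V (S - V)})"
  proof (rule arg_cong[where f = card], intro equalityI subsetI)
    fix q assume "q \<in> {q. q permutes A}"
    then have q: "q permutes A" by simp
    then have "inj_on q S" using permutes_inj inj_on_subset by blast
    then obtain V where "V \<subseteq> S" "card V = card U" "\<forall>u\<in>V. \<forall>v\<in>S - V. q u < q v"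
      using initial_segment_exists[of S q "card U"] fin cS by auto
    then show "q \<in> (\<Union>V\<in>\<V>. {q. q permutes A \<and> precedes q V (S - V)})"
      using q by (auto simp: \<V>_def precedes_def)
  qed auto
  also have "\<dots> = (\<Sum>V\<in>\<V>. card {q. q permutes A \<and> precedes q V (S - V)})"
  proof (rule card_UN_disjoint)
    show "\<forall>V\<in>\<V>. \<forall>V'\<in>\<V>. V \<noteq> V' \<longrightarrow> {q. q permutes A \<and> precedes q V (S - V)} \<inter>
        {q. q permutes A \<and> precedes q V' (S - V')} = {}"
    proof (intro ballI impI, rule ccontr)
      fix V V' assume V: "V \<in> \<V>" "V' \<in> \<V>" "V \<noteq> V'"
      assume "{q. q permutes A \<and> precedes q V (S - V)} \<inter> {q. q permutes A \<and> precedes q V' (S - V')} \<noteq> {}"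
      then obtain q where "precedes q V (S - V)" "precedes q V' (S - V')" by auto
      then show False using V initial_segment_unique[of S V V' q] fin by (auto simp: \<V>_def precedes_def)
    qed
    show "\<forall>V\<in>\<V>. finite {q. q permutes A \<and> precedes q V (S - V)}"
      using finP by (auto intro: finite_subset)
  qed (fact finV)
  also have "\<dots> = card \<V> * card {q. q permutes A \<and> precedes q U T}" using eq by simp
  also have "card \<V> = (card T + card U) choose card U"
    unfolding \<V>_def using n_subsets[OF fin(3)] cS by simp
  finally show ?thesis using card_permutations[OF refl assms(1)] by (simp add: mult.commute)
qed

text \<open>Only users disjoint from \<open>T\<close> can precede it. There are
  \<open>(\<Lambda> - card T) choose l\<close> of them, each preceding \<open>T\<close> in a
  fraction \<open>1 / ((card T + l) choose l)\<close> of the orders.\<close>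

lemma sum_card_precedes:
  assumes "T \<subseteq> {1..\<Lambda>}" "1 \<le> l"
  shows "(\<Sum>U\<in>users \<Lambda> l. real (card {q. q permutes {1..\<Lambda>} \<and> precedes q U T}))
      = fact \<Lambda> * load \<Lambda> l (card T)"
proof -
  let ?F = "\<lambda>U. real (card {q. q permutes {1..\<Lambda>} \<and> precedes q U T})"
  let ?D = "{U. U \<subseteq> {1..\<Lambda>} - T \<and> card U = l}"
  have finT: "finite T" using assms finite_subset by blast
  have cT: "card T \<le> \<Lambda>" using card_mono[OF _ assms(1)] by simp
  have "finite (users \<Lambda> l)" by (simp add: users_def)
  then have "(\<Sum>U\<in>users \<Lambda> l. ?F U) = (\<Sum>U\<in>?D. ?F U)"
  proof (rule sum.mono_neutral_right)
    show "?D \<subseteq> users \<Lambda> l" by (auto simp: users_def)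
    show "\<forall>U\<in>users \<Lambda> l - ?D. ?F U = 0"
    proof
      fix U assume "U \<in> users \<Lambda> l - ?D"
      then obtain x where "x \<in> U" "x \<in> T" by (auto simp: users_def)
      then have "{q. q permutes {1..\<Lambda>} \<and> precedes q U T} = {}" by (auto simp: precedes_def)
      then show "?F U = 0" by (metis card.empty of_nat_0)
    qed
  qed
  also have "\<dots> = (\<Sum>U\<in>?D. fact \<Lambda> / real ((card T + l) choose l))"
  proof (rule sum.cong)
    fix U assume "U \<in> ?D"
    then have U: "U \<subseteq> {1..\<Lambda>}" "U \<inter> T = {}" "card U = l" by auto
    have "card {q. q permutes {1..\<Lambda>} \<and> precedes q U T} * ((card T + l) choose l) = fact \<Lambda>"
      using card_precedes[OF _ U(1) assms(1) U(2)] U(3) by simp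
    then have "?F U * real ((card T + l) choose l) = fact \<Lambda>"
      by (metis of_nat_fact of_nat_mult)
    then show "?F U = fact \<Lambda> / real ((card T + l) choose l)"
      by (simp add: field_simps)
  qed simp
  also have "\<dots> = real (card ?D) * (fact \<Lambda> / real ((card T + l) choose l))" by simp
  also have "card ?D = (\<Lambda> - card T) choose l"
    using n_subsets[of "{1..\<Lambda>} - T" l] assms finT by (simp add: card_Diff_subset)
  finally show ?thesis using load_alt[OF cT, of l] by simp
qed

section \<open>Converse\<close>

lemma restrict_cache_content_eq_iff:
  "restrict (cache_content Z W) U = restrict (cache_content Z W') U
    \<longleftrightarrow> (\<forall>c\<in>U. \<forall>(n, i)\<in>Z c. W n ! i = W' n ! i)" (is "?L \<longleftrightarrow> ?R")
proof
  assume L: ?L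
  show ?R
  proof clarify
    fix c n i assume "c \<in> U" "(n, i) \<in> Z c"
    then show "W n ! i = W' n ! i"
      using fun_cong[OF fun_cong[OF L, of c], of "(n, i)"] by (simp add: cache_content_def)
  qed
next
  assume ?R
  then show ?L by (auto simp: fun_eq_iff cache_content_def restrict_def)
qed

text \<open>Decoders are eliminated: one exists exactly when message and cache contents determine
  the requested file, since it may then choose any library consistent with what it sees.\<close>

lemma delivers_iff:
  "delivers \<Lambda> l N B Z d L X \<longleftrightarrow>
     (\<forall>W\<in>libraries N B. length (X W) = L) \<and>
     (\<forall>U\<in>users \<Lambda> l. \<forall>W\<in>libraries N B. \<forall>W'\<in>libraries N B.
        X W = X W' \<longrightarrow> (\<forall>c\<in>U. \<forall>(n, i)\<in>Z c. W n ! i = W' n ! i) \<longrightarrow> W (d U) = W' (d U))"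
proof -
  let ?c = "\<lambda>W U. restrict (cache_content Z W) U"
  have "(\<exists>dec. \<forall>W\<in>libraries N B. dec (X W) (?c W U) = W (d U)) \<longleftrightarrow>
      (\<forall>W\<in>libraries N B. \<forall>W'\<in>libraries N B. X W = X W' \<longrightarrow> ?c W U = ?c W' U \<longrightarrow> W (d U) = W' (d U))"
    (is "?L \<longleftrightarrow> ?R") for U
  proof
    assume ?L then show ?R by metis
  next
    assume R: ?R
    define dec where "dec x y = (SOME W. W \<in> libraries N B \<and> X W = x \<and> ?c W U = y) (d U)" for x y
    have "dec (X W) (?c W U) = W (d U)" if W: "W \<in> libraries N B" for W
    proof -
      let ?V = "SOME V. V \<in> libraries N B \<and> X V = X W \<and> ?c V U = ?c W U"
      have "?V \<in> libraries N B \<and> X ?V = X W \<and> ?c ?V U = ?c W U"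
        by (rule someI[of "\<lambda>V. V \<in> libraries N B \<and> X V = X W \<and> ?c V U = ?c W U" W]) (use W in auto)
      then show ?thesis unfolding dec_def using R W by blast
    qed
    then show ?L by blast
  qed
  then show ?thesis unfolding delivers_def restrict_cache_content_eq_iff by simp
qed

text \<open>The subfile of file \<open>n\<close> indexed by a set \<open>T\<close> of caches
  consists of the positions \<open>i\<close> where this value is \<open>T\<close>.\<close>

definition stored_in :: "nat \<Rightarrow> (nat \<Rightarrow> (nat \<times> nat) set) \<Rightarrow> nat \<Rightarrow> nat \<Rightarrow> nat set" where
  "stored_in \<Lambda> Z n i = {c \<in> {1..\<Lambda>}. (n, i) \<in> Z c}"

lemma stored_in_subset: "stored_in \<Lambda> Z n i \<subseteq> {1..\<Lambda>}"
  by (auto simp: stored_in_def)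

text \<open>
  The acyclic index coding bound. If two libraries vanish outside the counted bits and give the
  same message, then the users decode the same files from both: by induction on the last position
  \<open>Max (q ` U)\<close>, every counted bit that \<open>U\<close> reads belongs to the demand of an earlier user.
\<close>
lemma delivers_length_ge:
  assumes del: "delivers \<Lambda> l N B Z d L X" and d: "d \<in> demands \<Lambda> l N" "inj_on d (users \<Lambda> l)"
    and l: "1 \<le> l" and Z: "\<And>c. c \<in> {1..\<Lambda>} \<Longrightarrow> Z c \<subseteq> {1..N} \<times> {..<B}"
  shows "card (SIGMA U:users \<Lambda> l. {i. i < B \<and> precedes q U (stored_in \<Lambda> Z (d U) i)}) \<le> L"
proof -
  define P where "P = (SIGMA U:users \<Lambda> l. {i. i < B \<and> precedes q U (stored_in \<Lambda> Z (d U) i)})"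
  define E where "E = (\<lambda>(U, i). (d U, i)) ` P"
  \<comment> \<open>The library whose one-bits are exactly those addressed by \<open>Y\<close>.
    Subsets of \<open>E\<close> thus give all patterns on the counted bits, with zeros
    elsewhere.\<close>
  define lib where "lib Y = restrict (\<lambda>n. map (\<lambda>i. (n, i) \<in> Y) [0..<B]) {1..N}" for Y :: "(nat \<times> nat) set"
  have finP: "finite P" unfolding P_def by (intro finite_SigmaI) (auto simp: users_def)
  have cE: "card E = card P" unfolding E_def
    by (rule card_image) (use d(2) in \<open>auto simp: inj_on_def P_def\<close>)
  have lib: "lib Y \<in> libraries N B" for Y by (auto simp: libraries_def lib_def)
  have lib_nth: "lib Y n ! i \<longleftrightarrow> (n, i) \<in> Y" if "n \<in> {1..N}" "i < B" for Y n i
    using that by (simp add: lib_def)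
  have dU: "d U \<in> {1..N}" if "U \<in> users \<Lambda> l" for U using d(1) that by (auto simp: demands_def)
  \<comment> \<open>Injectivity forces at least as many messages of length \<open>L\<close> as there
    are subsets of \<open>E\<close>, which gives the bound on \<open>L\<close>.\<close>
  have "inj_on (\<lambda>Y. X (lib Y)) (Pow E)"
  proof (rule inj_onI)
    fix Y Y' assume Y: "Y \<in> Pow E" "Y' \<in> Pow E" and X: "X (lib Y) = X (lib Y')"
    have dec: "lib Y (d U) = lib Y' (d U)" if "U \<in> users \<Lambda> l" for U
      using that
    proof (induction "Max (q ` U)" arbitrary: U rule: less_induct)
      case less
      have "\<forall>c\<in>U. \<forall>(n, i)\<in>Z c. lib Y n ! i = lib Y' n ! i"
      proof clarify
        fix c n i assume c: "c \<in> U" "(n, i) \<in> Z c"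
        have c\<Lambda>: "c \<in> {1..\<Lambda>}" using c less.prems by (auto simp: users_def)
        then have ni: "n \<in> {1..N}" "i < B" using Z[OF c\<Lambda>] c by auto
        show "lib Y n ! i = lib Y' n ! i"
        proof (cases "(n, i) \<in> E")
          case True
          then obtain V where V: "n = d V" "V \<in> users \<Lambda> l" "precedes q V (stored_in \<Lambda> Z (d V) i)"
            by (auto simp: E_def P_def)
          have fin: "finite V" "finite U" "V \<noteq> {}"
            using V less.prems l by (auto simp: users_def intro: finite_subset)
          have "c \<in> stored_in \<Lambda> Z (d V) i" using c c\<Lambda> V by (simp add: stored_in_def)
          then have "q v < q c" if "v \<in> V" for v using V(3) that by (auto simp: precedes_def)
          moreover have "q c \<le> Max (q ` U)" using c fin by simp
          ultimately have "\<forall>v\<in>V. q v < Max (q ` U)" using less_le_trans by blast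
          then have "Max (q ` V) < Max (q ` U)" using fin by simp
          then have "lib Y (d V) = lib Y' (d V)" using less.hyps V by blast
          then show ?thesis using V by simp
        next
          case False
          then show ?thesis using lib_nth[OF ni] Y by blast
        qed
      qed
      then show ?case using del X lib less.prems unfolding delivers_iff by blast
    qed
    have "(n, i) \<in> Y \<longleftrightarrow> (n, i) \<in> Y'" if ni: "(n, i) \<in> E" for n i
    proof -
      obtain V where V: "n = d V" "V \<in> users \<Lambda> l" "i < B" using ni by (auto simp: E_def P_def)
      show ?thesis using lib_nth[OF dU[OF V(2)] V(3)] dec[OF V(2)] V(1) by metis
    qed
    then show "Y = Y'" using Y by auto
  qed
  moreover have "(\<lambda>Y. X (lib Y)) ` Pow E \<subseteq> {xs. set xs \<subseteq> UNIV \<and> length xs = L}"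
    using del lib unfolding delivers_iff by auto
  moreover have "finite {xs :: bool list. set xs \<subseteq> UNIV \<and> length xs = L}"
    by (rule finite_lists_length_eq) simp
  ultimately have "card (Pow E) \<le> card {xs :: bool list. set xs \<subseteq> UNIV \<and> length xs = L}"
    using card_inj_on_le by blast
  also have "\<dots> = 2 ^ L" using card_lists_length_eq[of "UNIV :: bool set" L] by simp
  finally have "(2::nat) ^ card P \<le> 2 ^ L"
    using finP cE by (simp add: card_Pow E_def)
  then show ?thesis unfolding P_def by simp
qed

text \<open>The bound above is averaged over all permutations \<open>q\<close> and over the \<open>N\<close> cyclic shifts of one
  demand with distinct files.\<close>
lemma achievable_load_ge:
  assumes ach: "achievable_uncoded \<Lambda> l N M R"
    and l: "1 \<le> l" "l \<le> \<Lambda>" and N: "\<Lambda> choose l \<le> N" and t: "t < \<Lambda>"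
  shows "load \<Lambda> l t + (M * real \<Lambda> / real N - real t) * (load \<Lambda> l (Suc t) - load \<Lambda> l t) \<le> R"
proof -
  define D where "D = load \<Lambda> l (Suc t) - load \<Lambda> l t"
  have D: "D \<le> 0" unfolding D_def using load_step(1)[OF t l(1)] by simp
  have N0: "N > 0" using N l by (metis gr_zeroI le_zero_eq zero_less_binomial less_numeral_extra(3))
  obtain B Z where B: "B > 0" and Z: "uncoded_placement \<Lambda> N B M Z"
    and del: "\<And>d. d \<in> demands \<Lambda> l N \<Longrightarrow> \<exists>L X. delivers \<Lambda> l N B Z d L X \<and> real L \<le> R * real B"
    using ach unfolding achievable_uncoded_def by blast
  have Zsub: "Z c \<subseteq> {1..N} \<times> {..<B}" and Zcard: "real (card (Z c)) \<le> M * real B"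
    if "c \<in> {1..\<Lambda>}" for c using Z that unfolding uncoded_placement_def by auto
  have finU: "finite (users \<Lambda> l)" by (simp add: users_def)
  have cU: "card (users \<Lambda> l) = \<Lambda> choose l" unfolding users_def using n_subsets[of "{1..\<Lambda>}" l] by simp
  obtain e where e: "bij_betw e (users \<Lambda> l) {0..<card (users \<Lambda> l)}"
    using ex_bij_betw_finite_nat[OF finU] by blast
  have eN: "e U < N" if "U \<in> users \<Lambda> l" for U
    using bij_betwE[OF e] that cU N by fastforce
  \<comment> \<open>Cyclic shift by \<open>k\<close> of the numbering \<open>e\<close>, moved from
    \<open>0..N-1\<close> to \<open>1..N\<close>; one subtraction suffices as both summands are
    below \<open>N\<close>. Fixed \<open>k\<close> gives distinct files, while fixed
    \<open>U\<close> runs through every file once.\<close>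
  define d where "d k = restrict (\<lambda>U. if e U + k < N then e U + k + 1 else e U + k + 1 - N) (users \<Lambda> l)"
    for k
  have d_dem: "d k \<in> demands \<Lambda> l N" if "k < N" for k
    using that eN N0 by (fastforce simp: demands_def d_def)
  have d_inj: "inj_on (d k) (users \<Lambda> l)" if "k < N" for k
  proof (rule inj_onI)
    fix U V assume UV: "U \<in> users \<Lambda> l" "V \<in> users \<Lambda> l" "d k U = d k V"
    then have "e U = e V" using eN[OF UV(1)] eN[OF UV(2)] that by (auto simp: d_def split: if_splits)
    then show "U = V" using e UV by (auto simp: bij_betw_def dest: inj_onD)
  qed
  have d_bij: "bij_betw (\<lambda>k. d k U) {..<N} {1..N}" if U: "U \<in> users \<Lambda> l" for U
  proof -
    have "inj_on (\<lambda>k. d k U) {..<N}"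
      using U eN[OF U] by (intro inj_onI) (auto simp: d_def split: if_splits)
    moreover have "(\<lambda>k. d k U) ` {..<N} \<subseteq> {1..N}"
      using d_dem U by (auto simp: demands_def)
    ultimately show ?thesis
      unfolding bij_betw_def by (simp add: card_image card_subset_eq)
  qed
  let ?Q = "{q. q permutes {1..\<Lambda>}}"
  have finQ: "finite ?Q" by (simp add: finite_permutations)
  let ?b = "\<lambda>q U n i. of_bool (precedes q U (stored_in \<Lambda> Z n i)) :: real"
  have one: "(\<Sum>U\<in>users \<Lambda> l. \<Sum>i<B. ?b q U (d k U) i) \<le> R * real B" if k: "k < N" for k q
  proof -
    obtain L X where LX: "delivers \<Lambda> l N B Z (d k) L X" "real L \<le> R * real B"
      using del[OF d_dem[OF k]] by blast
    have "(\<Sum>i<B. ?b q U (d k U) i) = real (card {i. i < B \<and> precedes q U (stored_in \<Lambda> Z (d k U) i)})" for U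
      by (simp add: Int_def sum.If_cases of_bool_def)
    then have "(\<Sum>U\<in>users \<Lambda> l. \<Sum>i<B. ?b q U (d k U) i)
        = real (card (SIGMA U:users \<Lambda> l. {i. i < B \<and> precedes q U (stored_in \<Lambda> Z (d k U) i)}))"
      using finU by simp
    also have "\<dots> \<le> real L"
      using delivers_length_ge[OF LX(1) d_dem[OF k] d_inj[OF k] l(1) Zsub] by simp
    finally show ?thesis using LX(2) by simp
  qed
  have "(\<Sum>q\<in>?Q. \<Sum>k<N. \<Sum>U\<in>users \<Lambda> l. \<Sum>i<B. ?b q U (d k U) i) \<le> (\<Sum>q\<in>?Q. \<Sum>k<N. R * real B)"
    using one by (intro sum_mono) auto
  also have "\<dots> = fact \<Lambda> * (real N * (R * real B))"
    using card_permutations[of "{1..\<Lambda>}" \<Lambda>] by simp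
  also have "(\<Sum>q\<in>?Q. \<Sum>k<N. \<Sum>U\<in>users \<Lambda> l. \<Sum>i<B. ?b q U (d k U) i)
      = (\<Sum>q\<in>?Q. \<Sum>U\<in>users \<Lambda> l. \<Sum>k<N. \<Sum>i<B. ?b q U (d k U) i)"
    by (intro sum.cong refl sum.swap)
  \<comment> \<open>Over all shifts each user requests each file once, so the dependence on the
    demand disappears.\<close>
  also have "\<dots> = (\<Sum>q\<in>?Q. \<Sum>U\<in>users \<Lambda> l. \<Sum>n\<in>{1..N}. \<Sum>i<B. ?b q U n i)"
  proof (rule sum.cong[OF refl], rule sum.cong[OF refl])
    fix q :: "nat \<Rightarrow> nat" and U assume "U \<in> users \<Lambda> l"
    then show "(\<Sum>k<N. \<Sum>i<B. ?b q U (d k U) i) = (\<Sum>n\<in>{1..N}. \<Sum>i<B. ?b q U n i)"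
      using sum.reindex_bij_betw[OF d_bij, of U "\<lambda>n. \<Sum>i<B. ?b q U n i"] by blast
  qed
  also have "\<dots> = (\<Sum>U\<in>users \<Lambda> l. \<Sum>n\<in>{1..N}. \<Sum>i<B. \<Sum>q\<in>?Q. ?b q U n i)"
    by (subst sum.swap, intro sum.cong refl, subst sum.swap, intro sum.cong refl, rule sum.swap)
  also have "\<dots> = (\<Sum>n\<in>{1..N}. \<Sum>i<B. \<Sum>U\<in>users \<Lambda> l. \<Sum>q\<in>?Q. ?b q U n i)"
    by (subst sum.swap, intro sum.cong refl, rule sum.swap)
  also have "\<dots> = (\<Sum>n\<in>{1..N}. \<Sum>i<B. fact \<Lambda> * load \<Lambda> l (card (stored_in \<Lambda> Z n i)))"
  proof (intro sum.cong refl)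
    fix n i
    have "(\<Sum>q\<in>?Q. ?b q U n i) = real (card {q. q permutes {1..\<Lambda>} \<and> precedes q U (stored_in \<Lambda> Z n i)})" for U
      using finQ by (simp add: Int_def sum.If_cases of_bool_def)
    then show "(\<Sum>U\<in>users \<Lambda> l. \<Sum>q\<in>?Q. ?b q U n i) = fact \<Lambda> * load \<Lambda> l (card (stored_in \<Lambda> Z n i))"
      using sum_card_precedes[OF _ l(1), of "stored_in \<Lambda> Z n i" \<Lambda>] stored_in_subset by simp
  qed
  also have "\<dots> = fact \<Lambda> * (\<Sum>n\<in>{1..N}. \<Sum>i<B. load \<Lambda> l (card (stored_in \<Lambda> Z n i)))"
    by (simp add: sum_distrib_left)
  finally have "(\<Sum>n\<in>{1..N}. \<Sum>i<B. load \<Lambda> l (card (stored_in \<Lambda> Z n i))) \<le> real N * (R * real B)"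
    by simp
  \<comment> \<open>The memory constraint controls only the total number of stored copies, so the
    load of each bit is replaced by its linear lower bound.\<close>
  moreover have "(\<Sum>n\<in>{1..N}. \<Sum>i<B. load \<Lambda> l t + (real (card (stored_in \<Lambda> Z n i)) - real t) * D)
      \<le> (\<Sum>n\<in>{1..N}. \<Sum>i<B. load \<Lambda> l (card (stored_in \<Lambda> Z n i)))"
  proof (intro sum_mono)
    fix n i
    have "card (stored_in \<Lambda> Z n i) \<le> \<Lambda>"
      using card_mono[OF _ stored_in_subset] by fastforce
    then show "load \<Lambda> l t + (real (card (stored_in \<Lambda> Z n i)) - real t) * D
        \<le> load \<Lambda> l (card (stored_in \<Lambda> Z n i))"
      unfolding D_def by (rule load_ge_line[OF t l(1)])
  qed
  moreover have "(\<Sum>n\<in>{1..N}. \<Sum>i<B. load \<Lambda> l t + (real (card (stored_in \<Lambda> Z n i)) - real t) * D)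
      = real N * real B * (load \<Lambda> l t - real t * D) + D * (\<Sum>n\<in>{1..N}. \<Sum>i<B. real (card (stored_in \<Lambda> Z n i)))"
  proof -
    have "load \<Lambda> l t + (x - real t) * D = (load \<Lambda> l t - real t * D) + D * x" for x
      by (simp add: algebra_simps)
    then show ?thesis by (simp only: sum.distrib sum_distrib_left[symmetric]) simp
  qed
  \<comment> \<open>Count the incidences of bits and caches by cache instead of by bit.\<close>
  moreover have "(\<Sum>n\<in>{1..N}. \<Sum>i<B. real (card (stored_in \<Lambda> Z n i))) \<le> real \<Lambda> * (M * real B)"
  proof -
    have "(\<Sum>n\<in>{1..N}. \<Sum>i<B. real (card (stored_in \<Lambda> Z n i)))
        = (\<Sum>(n, i)\<in>{1..N} \<times> {..<B}. real (card (stored_in \<Lambda> Z n i)))"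
      by (rule sum.cartesian_product)
    also have "\<dots> = (\<Sum>x\<in>{1..N} \<times> {..<B}. \<Sum>c\<in>{1..\<Lambda>}. of_bool (x \<in> Z c))"
      by (intro sum.cong refl) (auto simp: stored_in_def Int_def sum.If_cases of_bool_def)
    also have "\<dots> = (\<Sum>c\<in>{1..\<Lambda>}. \<Sum>x\<in>{1..N} \<times> {..<B}. of_bool (x \<in> Z c))" by (rule sum.swap)
    also have "\<dots> = (\<Sum>c\<in>{1..\<Lambda>}. real (card (Z c)))"
    proof (intro sum.cong refl)
      fix c assume "c \<in> {1..\<Lambda>}"
      then have "({1..N} \<times> {..<B}) \<inter> Z c = Z c" using Zsub by auto
      then show "(\<Sum>x\<in>{1..N} \<times> {..<B}. of_bool (x \<in> Z c)) = real (card (Z c))"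
        by (simp add: sum.If_cases of_bool_def)
    qed
    also have "\<dots> \<le> (\<Sum>c\<in>{1..\<Lambda>}. M * real B)" using Zcard by (rule sum_mono)
    finally show ?thesis by simp
  qed
  \<comment> \<open>The slope \<open>D\<close> is nonpositive, so the upper bound on memory becomes
    a lower bound on load.\<close>
  then have "D * (\<Sum>n\<in>{1..N}. \<Sum>i<B. real (card (stored_in \<Lambda> Z n i))) \<ge> D * (real \<Lambda> * (M * real B))"
    using D by (rule mult_left_mono_neg)
  ultimately have "real N * real B * (load \<Lambda> l t - real t * D) + D * (real \<Lambda> * (M * real B))
      \<le> real N * (R * real B)" by linarith
  then have "(real N * (load \<Lambda> l t - real t * D) + D * (real \<Lambda> * M)) * real B \<le> (real N * R) * real B"
    by (simp add: algebra_simps)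
  then have "real N * (load \<Lambda> l t - real t * D) + D * (real \<Lambda> * M) \<le> real N * R"
    using B by simp
  then have "load \<Lambda> l t + (M * real \<Lambda> / real N - real t) * D \<le> R"
    using N0 by (simp add: field_simps)
  then show ?thesis unfolding D_def .
qed

section \<open>Achievability\<close>

text \<open>Achievability with sizes in whole bits and one message length for all demands, so that
  sizes add under concatenation. Allowing \<open>B = 0\<close> provides a neutral element.\<close>

definition scheme :: "nat \<Rightarrow> nat \<Rightarrow> nat \<Rightarrow> nat \<Rightarrow> nat \<Rightarrow> nat \<Rightarrow> bool" where
  "scheme \<Lambda> l N B m L \<longleftrightarrow>
     (\<exists>Z. (\<forall>c\<in>{1..\<Lambda>}. Z c \<subseteq> {1..N} \<times> {..<B} \<and> card (Z c) \<le> m) \<and>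
        (\<forall>d\<in>demands \<Lambda> l N. \<exists>X. delivers \<Lambda> l N B Z d L X))"

lemma scheme_achievable:
  assumes "scheme \<Lambda> l N B m L" "B > 0" "real m \<le> M * real B" "real L \<le> R * real B"
  shows "achievable_uncoded \<Lambda> l N M R"
proof -
  obtain Z where Z: "\<forall>c\<in>{1..\<Lambda>}. Z c \<subseteq> {1..N} \<times> {..<B} \<and> card (Z c) \<le> m"
    and del: "\<forall>d\<in>demands \<Lambda> l N. \<exists>X. delivers \<Lambda> l N B Z d L X"
    using assms(1) unfolding scheme_def by blast
  have "uncoded_placement \<Lambda> N B M Z"
    unfolding uncoded_placement_def using Z assms(3) by (meson of_nat_mono order_trans)
  moreover have "\<forall>d\<in>demands \<Lambda> l N. \<exists>L X. delivers \<Lambda> l N B Z d L X \<and> real L \<le> R * real B"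
    using del assms(4) by meson
  ultimately show ?thesis unfolding achievable_uncoded_def using assms(2) by (intro exI conjI)
qed

lemma scheme_0: "scheme \<Lambda> l N 0 0 0"
  unfolding scheme_def
proof (intro exI[of _ "\<lambda>_. {}"] conjI ballI)
  fix d assume d: "d \<in> demands \<Lambda> l N"
  have "W (d U) = W' (d U)"
    if "U \<in> users \<Lambda> l" "W \<in> libraries N 0" "W' \<in> libraries N 0" for U W W'
  proof -
    have "d U \<in> {1..N}" using d that by (auto simp: demands_def)
    then have "length (W (d U)) = 0" "length (W' (d U)) = 0"
      using that PiE_mem[of W "{1..N}"] PiE_mem[of W' "{1..N}"] unfolding libraries_def by blast+
    then show ?thesis by simp
  qed
  then show "\<exists>X. delivers \<Lambda> l N 0 (\<lambda>_. {}) d 0 X"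
    unfolding delivers_iff by (intro exI[of _ "\<lambda>_. []"]) auto
qed auto

text \<open>Memory sharing: the first \<open>B1\<close> bits of each file use one scheme, the
  remaining bits the other. The fixed length of the first message lets a receiver split the
  concatenation.\<close>

lemma scheme_add:
  assumes "scheme \<Lambda> l N B1 m1 L1" "scheme \<Lambda> l N B2 m2 L2"
  shows "scheme \<Lambda> l N (B1 + B2) (m1 + m2) (L1 + L2)"
proof -
  obtain Z1 where Z1: "\<And>c. c \<in> {1..\<Lambda>} \<Longrightarrow> Z1 c \<subseteq> {1..N} \<times> {..<B1} \<and> card (Z1 c) \<le> m1"
    and del1: "\<And>d. d \<in> demands \<Lambda> l N \<Longrightarrow> \<exists>X. delivers \<Lambda> l N B1 Z1 d L1 X"
    using assms(1) unfolding scheme_def by blast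
  obtain Z2 where Z2: "\<And>c. c \<in> {1..\<Lambda>} \<Longrightarrow> Z2 c \<subseteq> {1..N} \<times> {..<B2} \<and> card (Z2 c) \<le> m2"
    and del2: "\<And>d. d \<in> demands \<Lambda> l N \<Longrightarrow> \<exists>X. delivers \<Lambda> l N B2 Z2 d L2 X"
    using assms(2) unfolding scheme_def by blast
  define h where "h = (\<lambda>(n :: nat, i). (n, B1 + i))"
  define Z where "Z c = Z1 c \<union> h ` Z2 c" for c
  have "Z c \<subseteq> {1..N} \<times> {..<B1 + B2}" if "c \<in> {1..\<Lambda>}" for c
    using Z1[OF that] Z2[OF that] unfolding Z_def h_def by fastforce
  moreover have "card (Z c) \<le> m1 + m2" if "c \<in> {1..\<Lambda>}" for c
  proof -
    have "finite (Z2 c)" using Z2[OF that] finite_subset by blast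
    then have "card (h ` Z2 c) \<le> m2" using Z2[OF that] card_image_le le_trans by blast
    then show ?thesis
      using Z1[OF that] card_Un_le[of "Z1 c" "h ` Z2 c"] unfolding Z_def by linarith
  qed
  moreover have "\<exists>X. delivers \<Lambda> l N (B1 + B2) Z d (L1 + L2) X" if d: "d \<in> demands \<Lambda> l N" for d
  proof -
    obtain X1 where X1: "delivers \<Lambda> l N B1 Z1 d L1 X1" using del1[OF d] by blast
    obtain X2 where X2: "delivers \<Lambda> l N B2 Z2 d L2 X2" using del2[OF d] by blast
    define p1 where "p1 W = restrict (\<lambda>n. take B1 (W n)) {1..N}" for W :: "nat \<Rightarrow> bool list"
    define p2 where "p2 W = restrict (\<lambda>n. drop B1 (W n)) {1..N}" for W :: "nat \<Rightarrow> bool list"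
    have len: "length (W n) = B1 + B2" if "W \<in> libraries N (B1 + B2)" "n \<in> {1..N}" for W n
      using that by (auto simp: libraries_def)
    have p1: "p1 W \<in> libraries N B1" and p2: "p2 W \<in> libraries N B2"
      if "W \<in> libraries N (B1 + B2)" for W
      using len[OF that] by (auto simp: libraries_def p1_def p2_def)
    have "delivers \<Lambda> l N (B1 + B2) Z d (L1 + L2) (\<lambda>W. X1 (p1 W) @ X2 (p2 W))"
      unfolding delivers_iff
    proof (intro conjI ballI impI)
      fix W assume "W \<in> libraries N (B1 + B2)"
      then show "length (X1 (p1 W) @ X2 (p2 W)) = L1 + L2"
        using X1 X2 p1 p2 unfolding delivers_iff by simp
    next
      fix U W W' assume U: "U \<in> users \<Lambda> l" and W: "W \<in> libraries N (B1 + B2)"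
        and W': "W' \<in> libraries N (B1 + B2)"
        and X: "X1 (p1 W) @ X2 (p2 W) = X1 (p1 W') @ X2 (p2 W')"
        and c: "\<forall>c\<in>U. \<forall>(n, i)\<in>Z c. W n ! i = W' n ! i"
      have "length (X1 (p1 W)) = length (X1 (p1 W'))"
        using X1 p1 W W' unfolding delivers_iff by simp
      then have X': "X1 (p1 W) = X1 (p1 W')" "X2 (p2 W) = X2 (p2 W')" using X by auto
      have U\<Lambda>: "c \<in> {1..\<Lambda>}" if "c \<in> U" for c using U that by (auto simp: users_def)
      have "\<forall>c\<in>U. \<forall>(n, i)\<in>Z1 c. p1 W n ! i = p1 W' n ! i"
      proof clarify
        fix a n i assume a: "a \<in> U" "(n, i) \<in> Z1 a"
        then have "n \<in> {1..N}" "i < B1" using Z1[OF U\<Lambda>[OF a(1)]] by auto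
        moreover have "W n ! i = W' n ! i" using c a unfolding Z_def by blast
        ultimately show "p1 W n ! i = p1 W' n ! i" by (simp add: p1_def)
      qed
      then have 1: "p1 W (d U) = p1 W' (d U)"
        using X1 U p1[OF W] p1[OF W'] X'(1) unfolding delivers_iff by blast
      have "\<forall>c\<in>U. \<forall>(n, i)\<in>Z2 c. p2 W n ! i = p2 W' n ! i"
      proof clarify
        fix a n i assume a: "a \<in> U" "(n, i) \<in> Z2 a"
        then have n: "n \<in> {1..N}" using Z2[OF U\<Lambda>[OF a(1)]] by auto
        have "(n, B1 + i) \<in> Z a" using a unfolding Z_def h_def by force
        then have "W n ! (B1 + i) = W' n ! (B1 + i)" using c a(1) by blast
        then show "p2 W n ! i = p2 W' n ! i" using n len[OF W n] len[OF W' n] by (simp add: p2_def)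
      qed
      then have 2: "p2 W (d U) = p2 W' (d U)"
        using X2 U p2[OF W] p2[OF W'] X'(2) unfolding delivers_iff by blast
      have "d U \<in> {1..N}" using d U by (auto simp: demands_def)
      then have "take B1 (W (d U)) = take B1 (W' (d U))" "drop B1 (W (d U)) = drop B1 (W' (d U))"
        using 1 2 by (simp_all add: p1_def p2_def)
      then show "W (d U) = W' (d U)" by (metis append_take_drop_id)
    qed
    then show ?thesis by blast
  qed
  ultimately show ?thesis unfolding scheme_def by blast
qed

lemma scheme_mult:
  assumes "scheme \<Lambda> l N B m L"
  shows "scheme \<Lambda> l N (k * B) (k * m) (k * L)"
proof (induction k)
  case 0
  show ?case using scheme_0 by simp
next
  case (Suc k)
  then show ?case using scheme_add[OF assms] by simp
qed

section \<open>The multicasting scheme at a corner point\<close>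

text \<open>Counting by complement gives a form that also covers \<open>t = 0\<close>, where
  \<open>t - 1\<close> would mislead.\<close>

lemma card_subsets_containing:
  assumes "c \<in> {1..\<Lambda>}"
  shows "card {T. T \<subseteq> {1..\<Lambda>} \<and> card T = t \<and> c \<in> T} = (\<Lambda> choose t) - ((\<Lambda> - 1) choose t)"
proof -
  have eq: "{T. T \<subseteq> {1..\<Lambda>} \<and> card T = t \<and> c \<in> T}
      = {T. T \<subseteq> {1..\<Lambda>} \<and> card T = t} - {T. T \<subseteq> {1..\<Lambda>} - {c} \<and> card T = t}" by blast
  have "card ({1..\<Lambda>} - {c}) = \<Lambda> - 1" using assms by simp
  then show ?thesis
    unfolding eq by (subst card_Diff_subset) (auto simp: n_subsets)
qed

text \<open>Incidences of caches and \<open>t\<close>-sets, in numbers: each cache holds a fraction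
  \<open>t / \<Lambda>\<close> of every file in the scheme below.\<close>

lemma choose_diff_mult: "\<Lambda> * ((\<Lambda> choose t) - ((\<Lambda> - 1) choose t)) = t * (\<Lambda> choose t)"
proof (cases "t \<le> \<Lambda>")
  case True
  have "\<Lambda> * ((\<Lambda> - 1) choose t) = (\<Lambda> - t) * (\<Lambda> choose t)"
    by (rule binomial_absorb_comp[symmetric])
  then show ?thesis using True by (simp add: diff_mult_distrib2 diff_mult_distrib)
qed (simp add: binomial_eq_0)

text \<open>Bit \<open>i\<close> of every file is stored in the caches of the \<open>i\<close>-th \<open>t\<close>-set. For every \<open>(t + l)\<close>-set
  \<open>S\<close> the parity of the bits \<open>S - V\<close> of the files \<open>d V\<close>, \<open>V \<subseteq> S\<close>, is sent: user \<open>U \<subseteq> S\<close> reads all of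
  these bits except its own one.\<close>
lemma scheme_subsets:
  "scheme \<Lambda> l N (\<Lambda> choose t) (N * ((\<Lambda> choose t) - ((\<Lambda> - 1) choose t))) (\<Lambda> choose (t + l))"
proof -
  define B where "B = \<Lambda> choose t"
  define L where "L = \<Lambda> choose (t + l)"
  define \<T> where "\<T> k = {T. T \<subseteq> {1..\<Lambda>} \<and> card T = k}" for k
  have fin\<T>: "finite (\<T> k)" for k by (simp add: \<T>_def)
  have card\<T>: "card (\<T> k) = \<Lambda> choose k" for k unfolding \<T>_def using n_subsets[of "{1..\<Lambda>}" k] by simp
  obtain e where e: "bij_betw e {..<B} (\<T> t)"
    using ex_bij_betw_nat_finite[OF fin\<T>[of t]] card\<T> unfolding B_def atLeast0LessThan by auto
  obtain s where s: "bij_betw s {..<L} (\<T> (t + l))"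
    using ex_bij_betw_nat_finite[OF fin\<T>[of "t + l"]] card\<T> unfolding L_def atLeast0LessThan by auto
  define pos where "pos = inv_into {..<B} e"
  have pos: "pos T < B" "e (pos T) = T" if "T \<in> \<T> t" for T
    using that e inv_into_into[of T e "{..<B}"] f_inv_into_f[of T e "{..<B}"]
    unfolding pos_def bij_betw_def by auto
  have pos_e: "pos (e i) = i" if "i < B" for i
    unfolding pos_def using bij_betw_inv_into_left[OF e] that by simp
  define Z where "Z c = {1..N} \<times> {i. i < B \<and> c \<in> e i}" for c
  have Zcard: "card (Z c) = N * ((\<Lambda> choose t) - ((\<Lambda> - 1) choose t))" if "c \<in> {1..\<Lambda>}" for c
  proof -
    have "bij_betw e {i. i < B \<and> c \<in> e i} {T \<in> \<T> t. c \<in> T}"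
      using e unfolding bij_betw_def by (auto intro: inj_on_subset)
    then have "card {i. i < B \<and> c \<in> e i} = card {T \<in> \<T> t. c \<in> T}" by (rule bij_betw_same_card)
    also have "{T \<in> \<T> t. c \<in> T} = {T. T \<subseteq> {1..\<Lambda>} \<and> card T = t \<and> c \<in> T}" by (auto simp: \<T>_def)
    finally show ?thesis using card_subsets_containing[OF that, of t] by (simp add: Z_def)
  qed
  have "\<exists>X. delivers \<Lambda> l N B Z d L X" if d: "d \<in> demands \<Lambda> l N" for d
  proof -
    have dU: "d U \<in> {1..N}" if "U \<in> users \<Lambda> l" for U using d that by (auto simp: demands_def)
    \<comment> \<open>The parity of the cardinality of \<open>A W S\<close> is the XOR of the bits
      combined for \<open>S\<close>.\<close>
    define A where "A W S = {V. V \<subseteq> S \<and> card V = l \<and> W (d V) ! pos (S - V)}"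
      for W :: "nat \<Rightarrow> bool list" and S
    define X where "X W = map (\<lambda>k. odd (card (A W (s k)))) [0..<L]" for W
    have "delivers \<Lambda> l N B Z d L X"
      unfolding delivers_iff
    proof (intro conjI ballI impI)
      fix U W W' assume U: "U \<in> users \<Lambda> l" and W: "W \<in> libraries N B" "W' \<in> libraries N B"
        and X: "X W = X W'" and c: "\<forall>c\<in>U. \<forall>(n, i)\<in>Z c. W n ! i = W' n ! i"
      have U': "U \<subseteq> {1..\<Lambda>}" "card U = l" "finite U"
        using U by (auto simp: users_def intro: finite_subset)
      have known: "W (d V) ! i = W' (d V) ! i" if "V \<in> users \<Lambda> l" "i < B" "a \<in> U" "a \<in> e i" for V i a
        using c dU[OF that(1)] that unfolding Z_def by blast
      have "W (d U) ! i = W' (d U) ! i" if i: "i < B" for i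
      proof (cases "U \<inter> e i = {}")
        case False
        then show ?thesis using known[OF U i] by blast
      next
        case True
        have "e i \<in> \<T> t" using e i by (auto simp: bij_betw_def)
        then have ei: "e i \<subseteq> {1..\<Lambda>}" "card (e i) = t" "finite (e i)"
          by (auto simp: \<T>_def intro: finite_subset)
        \<comment> \<open>Since \<open>S - U = e i\<close>, the multicast for this \<open>S\<close>
          contains the missing bit as its term for \<open>V = U\<close>.\<close>
        define S where "S = e i \<union> U"
        have finS: "finite S" using ei U' by (simp add: S_def)
        have cS: "card S = t + l" unfolding S_def using ei U' True by (subst card_Un_disjoint) auto
        then have "S \<in> \<T> (t + l)" using ei U' by (auto simp: \<T>_def S_def)
        then have "S \<in> s ` {..<L}" using s by (simp add: bij_betw_def)
        then obtain k where k: "k < L" "s k = S" by auto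
        have "X W ! k = X W' ! k" using X by simp
        then have odd: "odd (card (A W S)) = odd (card (A W' S))" using k by (simp add: X_def)
        have "V \<in> A W S \<longleftrightarrow> V \<in> A W' S" if VU: "V \<noteq> U" for V
        proof (cases "V \<subseteq> S \<and> card V = l")
          case V: True
          then have finV: "finite V" using finS finite_subset by blast
          \<comment> \<open>Another \<open>l\<close>-set \<open>V\<close> misses some cache
            \<open>a\<close> of \<open>U\<close>; then \<open>a\<close> lies in \<open>S - V\<close>
            and stores the bit meant for \<open>V\<close>.\<close>
          then obtain a where a: "a \<in> U" "a \<notin> V"
            using VU V U'(2) card_subset_eq[of V U] by auto
          have "S - V \<in> \<T> t"
            using V finV cS ei U' by (auto simp: \<T>_def S_def card_Diff_subset)
          then have "pos (S - V) < B" "a \<in> e (pos (S - V))" using pos a by (auto simp: S_def)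
          moreover have "V \<in> users \<Lambda> l" using V ei U' by (auto simp: users_def S_def)
          ultimately show ?thesis using known[of V _ a] a by (auto simp: A_def)
        qed (auto simp: A_def)
        then have rest: "A W S - {U} = A W' S - {U}" by blast
        have card: "card (A V S) = card (A V S - {U}) + of_bool (U \<in> A V S)" for V
        proof -
          have "finite (A V S)" using finS by (simp add: A_def)
          then show ?thesis using card.remove[of "A V S" U] by auto
        qed
        have "U \<in> A W S \<longleftrightarrow> U \<in> A W' S"
          using odd card[of W] card[of W'] rest by (auto split: if_splits)
        moreover have "S - U = e i" using True by (auto simp: S_def)
        ultimately show ?thesis using pos_e[OF i] U' by (simp add: A_def S_def)
      qed
      moreover have "length (W (d U)) = B" "length (W' (d U)) = B"
        using W dU[OF U] unfolding libraries_def by auto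
      ultimately show "W (d U) = W' (d U)" by (simp add: nth_equalityI)
    qed (simp add: X_def)
    then show ?thesis by blast
  qed
  then have "scheme \<Lambda> l N B (N * ((\<Lambda> choose t) - ((\<Lambda> - 1) choose t))) L"
    unfolding scheme_def using Zcard by (intro exI[of _ Z]) (auto simp: Z_def)
  then show ?thesis unfolding B_def L_def .
qed

section \<open>Memory sharing between corners and the optimal load\<close>

text \<open>Adjacent corner schemes are mixed in the ratio \<open>a : b\<close>. The memory
  condition is an inequality so that a rational proportion can serve an arbitrary real
  \<open>M\<close>.\<close>

lemma achievable_between:
  assumes t: "t < \<Lambda>" and N: "N > 0" and ab: "a + b > 0"
    and M: "real t + real b / real (a + b) \<le> M * real \<Lambda> / real N"
  shows "achievable_uncoded \<Lambda> l N M
    (load \<Lambda> l t + real b / real (a + b) * (load \<Lambda> l (Suc t) - load \<Lambda> l t))"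
proof -
  define C where "C = (\<Lambda> choose t)"
  define C' where "C' = (\<Lambda> choose Suc t)"
  define m where "m = N * (C - ((\<Lambda> - 1) choose t))"
  define m' where "m' = N * (C' - ((\<Lambda> - 1) choose Suc t))"
  define K where "K = \<Lambda> choose (t + l)"
  define K' where "K' = \<Lambda> choose (Suc t + l)"
  have C: "C > 0" "C' > 0" using t by (auto simp: C_def C'_def)
  have "\<Lambda> * m = N * (t * C)" "\<Lambda> * m' = N * (Suc t * C')"
    unfolding m_def m'_def C_def C'_def
    using choose_diff_mult[of \<Lambda> t] choose_diff_mult[of \<Lambda> "Suc t"] by (metis mult.left_commute)+
  then have m: "real \<Lambda> * real m = real N * (real t * real C)"
    "real \<Lambda> * real m' = real N * (real (Suc t) * real C')" by (metis of_nat_mult)+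
  have ld: "load \<Lambda> l t = real K / real C" "load \<Lambda> l (Suc t) = real K' / real C'"
    by (auto simp: load_def K_def K'_def C_def C'_def)
  have "scheme \<Lambda> l N C m K" unfolding C_def m_def K_def by (rule scheme_subsets)
  moreover have "scheme \<Lambda> l N C' m' K'" unfolding C'_def m'_def K'_def by (rule scheme_subsets)
  \<comment> \<open>Taking \<open>a * C'\<close> copies of the first scheme and \<open>b * C\<close>
    of the second measures both file parts in the common unit \<open>C * C'\<close>.\<close>
  ultimately have "scheme \<Lambda> l N (a * C' * C + b * C * C') (a * C' * m + b * C * m') (a * C' * K + b * C * K')"
    by (intro scheme_add scheme_mult)
  then show ?thesis
  proof (rule scheme_achievable)
    have B: "real (a * C' * C + b * C * C') = real (a + b) * (real C * real C')"
      by (simp add: algebra_simps)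
    show "a * C' * C + b * C * C' > 0" using C ab by auto
    have pos: "real (a + b) > 0" "real \<Lambda> > 0" "real N > 0" using ab t N by auto
    have "real \<Lambda> * real (a * C' * m + b * C * m')
        = real a * real C' * (real \<Lambda> * real m) + real b * real C * (real \<Lambda> * real m')"
      by (simp add: algebra_simps)
    also have "\<dots> = real N * (real t * real (a + b) + real b) * (real C * real C')"
      unfolding m by (simp add: algebra_simps)
    also have "real t * real (a + b) + real b = (real t + real b / real (a + b)) * real (a + b)"
      using pos by (simp add: distrib_right)
    also have "real N * ((real t + real b / real (a + b)) * real (a + b)) * (real C * real C')
        \<le> real N * ((M * real \<Lambda> / real N) * real (a + b)) * (real C * real C')"
      using M by (intro mult_right_mono mult_left_mono) auto
    also have "\<dots> = real \<Lambda> * (M * real (a * C' * C + b * C * C'))"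
      unfolding B using pos by simp
    finally show "real (a * C' * m + b * C * m') \<le> M * real (a * C' * C + b * C * C')"
      using pos by simp
    have "(load \<Lambda> l t + real b / real (a + b) * (load \<Lambda> l (Suc t) - load \<Lambda> l t)) * real (a + b)
       = load \<Lambda> l t * real (a + b) + real b * (load \<Lambda> l (Suc t) - load \<Lambda> l t)"
      using pos by (simp add: distrib_right)
    also have "\<dots> = load \<Lambda> l t * real a + load \<Lambda> l (Suc t) * real b" by (simp add: algebra_simps)
    finally have "(load \<Lambda> l t + real b / real (a + b) * (load \<Lambda> l (Suc t) - load \<Lambda> l t))
        * real (a * C' * C + b * C * C') = (load \<Lambda> l t * real a + load \<Lambda> l (Suc t) * real b) * (real C * real C')"
      unfolding B mult.assoc[symmetric] by simp
    also have "\<dots> = real (a * C' * K + b * C * K')"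
      unfolding ld using C by (simp add: field_simps)
    finally show "real (a * C' * K + b * C * K') \<le>
        (load \<Lambda> l t + real b / real (a + b) * (load \<Lambda> l (Suc t) - load \<Lambda> l t))
        * real (a * C' * C + b * C * C')" by simp
  qed
qed

text \<open>The converse bounds the infimum below; rational proportions approaching
  \<open>\<theta>\<close> from below bound it above.\<close>

lemma optimal_load_eq:
  assumes l: "1 \<le> l" "l \<le> \<Lambda>" and N: "\<Lambda> choose l \<le> N" and t: "t < \<Lambda>"
    and M: "real t \<le> M * real \<Lambda> / real N" "M * real \<Lambda> / real N \<le> real t + 1"
  shows "optimal_load_uncoded \<Lambda> l N M
    = load \<Lambda> l t + (M * real \<Lambda> / real N - real t) * (load \<Lambda> l (Suc t) - load \<Lambda> l t)"
proof -
  define D where "D = load \<Lambda> l (Suc t) - load \<Lambda> l t"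
  define \<theta> where "\<theta> = M * real \<Lambda> / real N - real t"
  have \<theta>: "0 \<le> \<theta>" "\<theta> \<le> 1" using M by (auto simp: \<theta>_def)
  have D: "D \<le> 0" unfolding D_def using load_step(1)[OF t l(1)] by simp
  have N0: "N > 0" using N l zero_less_binomial[of l \<Lambda>] by linarith
  have lower: "load \<Lambda> l t + \<theta> * D \<le> R" if "achievable_uncoded \<Lambda> l N M R" for R
    using achievable_load_ge[OF that l N t] unfolding \<theta>_def D_def .
  then have bdd: "bdd_below {R. achievable_uncoded \<Lambda> l N M R}" by (auto simp: bdd_below_def)
  have ach: "achievable_uncoded \<Lambda> l N M (load \<Lambda> l t + real b / real (a + b) * D)"
    if "a + b > 0" "real b / real (a + b) \<le> \<theta>" for a b
    using achievable_between[OF t N0 that(1)] that(2) unfolding D_def \<theta>_def by simp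
  have "optimal_load_uncoded \<Lambda> l N M \<le> load \<Lambda> l t + \<theta> * D"
  proof (rule field_le_epsilon)
    fix \<epsilon> :: real assume "\<epsilon> > 0"
    \<comment> \<open>Rounding \<open>\<theta>\<close> down to a multiple of \<open>1 / n\<close>
      respects the memory and costs at most \<open>- D / n\<close>, which this choice keeps below
      \<open>\<epsilon>\<close>.\<close>
    obtain n :: nat where n: "- D / \<epsilon> < real n" "n > 0"
      using reals_Archimedean2[of "max 0 (- D / \<epsilon>)"] by auto
    define b where "b = nat \<lfloor>\<theta> * real n\<rfloor>"
    have "real b \<le> \<theta> * real n" "\<theta> * real n \<le> real b + 1"
      unfolding b_def using \<theta> by (auto simp: of_nat_nat)
    moreover have "\<theta> * real n \<le> real n" using \<theta> by (simp add: mult_left_le_one_le)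
    moreover have "\<theta> - 1 / real n = (\<theta> * real n - 1) / real n" using n by (simp add: field_simps)
    moreover from calculation have "b \<le> n" by linarith
    ultimately have b: "real b / real n \<le> \<theta>" "\<theta> - 1 / real n \<le> real b / real n" "b \<le> n"
      using n by (simp_all add: divide_le_eq divide_right_mono)
    have "optimal_load_uncoded \<Lambda> l N M \<le> load \<Lambda> l t + real b / real n * D"
      unfolding optimal_load_uncoded_def
      using ach[of "n - b" b] b n by (intro cInf_lower bdd) auto
    also have "\<dots> \<le> load \<Lambda> l t + (\<theta> - 1 / real n) * D"
      using mult_right_mono_neg[OF b(2) D] by simp
    also have "\<dots> \<le> load \<Lambda> l t + \<theta> * D + \<epsilon>"
      using n \<open>\<epsilon> > 0\<close> by (simp add: field_simps)
    finally show "optimal_load_uncoded \<Lambda> l N M \<le> load \<Lambda> l t + \<theta> * D + \<epsilon>" .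
  qed
  \<comment> \<open>The instance \<open>ach[of 1 0]\<close>, the pure scheme at corner
    \<open>t\<close>, shows that the infimum is over a nonempty set.\<close>
  moreover have "load \<Lambda> l t + \<theta> * D \<le> optimal_load_uncoded \<Lambda> l N M"
    unfolding optimal_load_uncoded_def
    using ach[of 1 0] \<theta> lower by (intro cInf_greatest) auto
  ultimately show ?thesis unfolding \<theta>_def D_def by simp
qed

theorem theorem1:
  fixes \<Lambda> l N :: nat
  assumes "1 \<le> \<Lambda>" and "l \<in> {1..\<Lambda>}" and "\<Lambda> choose l \<le> N"
  shows "(\<forall>t\<in>{0..\<Lambda>}. optimal_load_uncoded \<Lambda> l N (real t * (real N / real \<Lambda>))
            = real (\<Lambda> choose (t + l)) / real (\<Lambda> choose t))
       \<and> (\<forall>t\<in>{0..<\<Lambda>}. affine_fun_on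
            {real t * (real N / real \<Lambda>)..(real t + 1) * (real N / real \<Lambda>)}
            (optimal_load_uncoded \<Lambda> l N))"
proof -
  have l: "1 \<le> l" "l \<le> \<Lambda>" using assms(2) by auto
  have pos: "real N > 0" "real \<Lambda> > 0"
    using assms(1,3) l zero_less_binomial[of l \<Lambda>] by linarith+
  have scale: "x * (real N / real \<Lambda>) * real \<Lambda> / real N = x" for x using pos by simp
  note opt = optimal_load_eq[OF l assms(3)]
  have "optimal_load_uncoded \<Lambda> l N (real t * (real N / real \<Lambda>)) = load \<Lambda> l t" if "t \<le> \<Lambda>" for t
  proof (cases "t = \<Lambda>")
    \<comment> \<open>The last corner starts no interval and is reached as the right end of the
      preceding one.\<close>
    case True
    then obtain u where u: "t = Suc u" using assms(1) by (cases t) auto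
    show ?thesis
      using opt[of u "real t * (real N / real \<Lambda>)"] that unfolding scale u by simp
  next
    case False
    then show ?thesis
      using opt[of t "real t * (real N / real \<Lambda>)"] that unfolding scale by simp
  qed
  moreover have "affine_fun_on {real t * (real N / real \<Lambda>)..(real t + 1) * (real N / real \<Lambda>)}
      (optimal_load_uncoded \<Lambda> l N)" if "t < \<Lambda>" for t
    unfolding affine_fun_on_def
  proof (intro exI ballI)
    let ?D = "load \<Lambda> l (Suc t) - load \<Lambda> l t"
    fix M assume "M \<in> {real t * (real N / real \<Lambda>)..(real t + 1) * (real N / real \<Lambda>)}"
    then have "real t \<le> M * real \<Lambda> / real N" "M * real \<Lambda> / real N \<le> real t + 1"
      using pos by (auto simp: field_simps)
    from opt[OF that this]
    show "optimal_load_uncoded \<Lambda> l N M = (real \<Lambda> / real N * ?D) * M + (load \<Lambda> l t - real t * ?D)"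
      by (simp add: algebra_simps)
  qed
  ultimately show ?thesis unfolding load_def by auto
qed

end
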